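(* Let $g=3$, $\mathfrak i=1$. If $\sigma_1\in\mathfrak D_0\cup\mathfrak D_1$ and $\sigma_2\in\mathfrak D_*$ (subsets of $S(3,1)^{open}$), then $\sigma_1$ and $\sigma_2$ are not D-equivalent.
   Context: Let $p$ be an odd prime and $K=\mathbb Q(\sqrt{-\Delta})$ ($\Delta>0$ a squarefree integer) an imaginary quadratic field in which $p$ is inert. Put $\mathbb Z_{p^2}=\mathbb Z_p[\sqrt{-\Delta}]$, $\mathbb F_{p^2}=\mathbb F_p[\sqrt{-\Delta}]$; bar denotes the nontrivial automorphism, tilde denotes reduction modulo $p$; for $x=a+b\sqrt{-\Delta}$ put $\operatorname{im}x=b$ (entrywise for matrices). Let $E=\mathrm{diag}(1,-1,-1)$ (signature $(\mathfrak r,\mathfrak s)=(1,2)$). $G_V(\mathbb Z_p)$ is the group of $\mathfrak g=h+k\sqrt{-\Delta}$, $h,k\in M_3(\mathbb Z_p)$, with $\mathfrak gE\bar{\mathfrak g}^t=\lambda E$, $\lambda\in\mathbb Z_p^*$; $\alpha(\mathfrak g)=\begin{pmatrix} h& kE\\ -\Delta Ek& EhE\end{pmatrix}\in GSp_{6}(\mathbb Z_p)$. $S(3,1)^{open}$ is the set of matrices (diagonal blocks of sizes $1,2,1,2$) $$\sigma=\begin{pmatrix} p&0&0&pC^t\\ -A&1&C&U\\ 0&0&p&pA^t\\ 0&0&0&p^2\end{pmatrix},$$ where $A,C$ are integer $2\times1$ matrices with entries in a fixed system of residues modulo $p$, and $U$ is an integer $2\times2$ matrix with diagonal and upper-triangular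 entries in a fixed system of residues modulo $p^2$ and $CA^t-AC^t=U-U^t$. For such $\sigma$ put $$\mu_1=\begin{pmatrix}-1&-C^t\sqrt{-\Delta}\\ A+C\sqrt{-\Delta}&-1-U\sqrt{-\Delta}\end{pmatrix},\quad \mu_2=\begin{pmatrix}\sqrt{-\Delta}&-A^t\sqrt{-\Delta}\\ A+C\sqrt{-\Delta}&-1-U\sqrt{-\Delta}\end{pmatrix}.$$ If $\det\tilde\mu_1\ne0$, define $X_1,X_2$ by $\mu_2=\begin{pmatrix}X_1&X_2\\0&1\end{pmatrix}\mu_1$; then $\sigma\in\mathfrak D_j$ iff $\operatorname{rank}\operatorname{im}\tilde X_1=j$ ($j=0,1$). If $\det\tilde\mu_1=0$ and $\det\tilde\mu_2\ne0$, $\mathfrak D_j$ is defined in the same way with the roles of $\mu_1,\mu_2$ interchanged. $\sigma\in\mathfrak D_*$ iff $\det\tilde\mu_1=\det\tilde\mu_2=0$. Two elements $\sigma_1,\sigma_2$ are D-equivalent if there exists $\mathfrak g\in G_V(\mathbb Z_p)$ such that $\sigma_1\alpha(\mathfrak g)\sigma_2^{-1}$ has entries in $\mathbb Z_p$ (equivalently lies in $GSp_{6}(\mathbb Z_p)$). *)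

theory Defs
  imports
    Complex_Main
    "HOL-Algebra.Ideal"
    "HOL-Computational_Algebra.Normalized_Fraction"
    "HOL-Computational_Algebra.Squarefree"
    "Jordan_Normal_Form.Determinant"
    "Jordan_Normal_Form.DL_Rank"
    "Berlekamp_Zassenhaus.Finite_Field"
begin

section \<open>The rings \<open>\<int>\<^sub>p\<close> and \<open>\<int>\<^sub>p[\<surd>-\<Delta>]\<close>\<close>

text \<open>The prime \<open>p\<close> is \<open>CARD('p)\<close>. An element of \<open>\<int>\<^sub>p = lim \<int>/p\<^sup>n\<close> is given by its residues
  modulo \<open>p\<^sup>n\<close>; the condition below also forces \<open>0 \<le> x n < p\<^sup>n\<close>.\<close>

typedef ('p :: prime_card) padic_int =
  "{x :: nat \<Rightarrow> int. \<forall>n. x (Suc n) mod int CARD('p) ^ n = x n}"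
  by (rule exI[of _ "\<lambda>_. 0"]) simp

setup_lifting type_definition_padic_int

lemma padic_coherent:
  fixes x :: "'p :: prime_card padic_int"
  assumes "m \<le> n"
  shows "Rep_padic_int x n mod int CARD('p) ^ m = Rep_padic_int x m"
  using assms
proof (induction n rule: dec_induct)
  case base
  have "Rep_padic_int x (Suc m) mod int CARD('p) ^ m = Rep_padic_int x m"
    using Rep_padic_int[of x] by blast
  then show ?case by (metis mod_mod_trivial)
next
  case (step n)
  have "Rep_padic_int x (Suc n) mod int CARD('p) ^ n = Rep_padic_int x n"
    using Rep_padic_int[of x] by blast
  moreover have "int CARD('p) ^ m dvd int CARD('p) ^ n"
    using step.hyps by (intro le_imp_power_dvd) simp
  ultimately show ?case
    using step.IH by (metis mod_mod_cancel)
qed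

lemma padic_eqI: "(\<And>n. Rep_padic_int x n = Rep_padic_int y n) \<Longrightarrow> x = y"
  by (auto simp: Rep_padic_int_inject[symmetric])

lemma padic_mod_mod [simp]: "(a mod (m :: int) ^ Suc n) mod m ^ n = a mod m ^ n"
  by (rule mod_mod_cancel) simp

lemma padic_add_compatible:
  fixes a b c d m :: int
  assumes "a mod m ^ n = c" "b mod m ^ n = d"
  shows "((a + b) mod m ^ Suc n) mod m ^ n = (c + d) mod m ^ n"
  unfolding padic_mod_mod assms[symmetric] by (simp only: mod_add_eq)

lemma padic_diff_compatible:
  fixes a b c d m :: int
  assumes "a mod m ^ n = c" "b mod m ^ n = d"
  shows "((a - b) mod m ^ Suc n) mod m ^ n = (c - d) mod m ^ n"
  unfolding padic_mod_mod assms[symmetric] by (simp only: mod_diff_eq)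

lemma padic_mult_compatible:
  fixes a b c d m :: int
  assumes "a mod m ^ n = c" "b mod m ^ n = d"
  shows "((a * b) mod m ^ Suc n) mod m ^ n = (c * d) mod m ^ n"
  unfolding padic_mod_mod assms[symmetric] by (simp only: mod_mult_eq)

lemma padic_minus_compatible:
  fixes a c m :: int
  assumes "a mod m ^ n = c"
  shows "((- a) mod m ^ Suc n) mod m ^ n = (- c) mod m ^ n"
  unfolding padic_mod_mod assms[symmetric] by (simp only: mod_minus_eq)

instantiation padic_int :: (prime_card) comm_ring_1
begin

lift_definition zero_padic_int :: "'a padic_int" is "\<lambda>_. 0" by simp

lift_definition one_padic_int :: "'a padic_int" is "\<lambda>n. 1 mod int CARD('a) ^ n"
  by (simp only: padic_mod_mod)

lift_definition plus_padic_int :: "'a padic_int \<Rightarrow> 'a padic_int \<Rightarrow> 'a padic_int"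
  is "\<lambda>x y n. (x n + y n) mod int CARD('a) ^ n"
  by (rule padic_add_compatible)

lift_definition minus_padic_int :: "'a padic_int \<Rightarrow> 'a padic_int \<Rightarrow> 'a padic_int"
  is "\<lambda>x y n. (x n - y n) mod int CARD('a) ^ n"
  by (rule padic_diff_compatible)

lift_definition times_padic_int :: "'a padic_int \<Rightarrow> 'a padic_int \<Rightarrow> 'a padic_int"
  is "\<lambda>x y n. (x n * y n) mod int CARD('a) ^ n"
  by (rule padic_mult_compatible)

lift_definition uminus_padic_int :: "'a padic_int \<Rightarrow> 'a padic_int"
  is "\<lambda>x n. (- x n) mod int CARD('a) ^ n"
  by (rule padic_minus_compatible)

lemmas padic_rep_eq = zero_padic_int.rep_eq one_padic_int.rep_eq plus_padic_int.rep_eq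
  minus_padic_int.rep_eq uminus_padic_int.rep_eq times_padic_int.rep_eq

instance
proof
  fix a b c :: "'a padic_int"
  have r: "Rep_padic_int a n mod int CARD('a) ^ n = Rep_padic_int a n" for n
    by (rule padic_coherent) simp
  show "a + b + c = a + (b + c)" "a * b * c = a * (b * c)" "(a + b) * c = a * c + b * c"
    by (rule padic_eqI, simp add: padic_rep_eq mod_simps algebra_simps)+
  show "a + b = b + a" "a * b = b * a"
    by (rule padic_eqI, simp add: padic_rep_eq add.commute mult.commute)+
  show "0 + a = a" "1 * a = a"
    by (rule padic_eqI, simp add: padic_rep_eq mod_simps r)+
  show "- a + a = 0" "a - b = a + - b"
    by (rule padic_eqI, simp add: padic_rep_eq mod_simps)+
  have "Rep_padic_int (0 :: 'a padic_int) 1 \<noteq> Rep_padic_int (1 :: 'a padic_int) 1"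
    by (simp add: padic_rep_eq)
  then show "(0 :: 'a padic_int) \<noteq> 1"
    by metis
qed

end

instance padic_int :: (prime_card) idom
proof
  fix x y :: "'a padic_int"
  let ?p = "int CARD('a)"
  assume "x \<noteq> 0" "y \<noteq> 0"
  then obtain m n where mn: "Rep_padic_int x m \<noteq> 0" "Rep_padic_int y n \<noteq> 0"
    by (metis Rep_padic_int_inject zero_padic_int.rep_eq ext)
  let ?k = "m + n"
  have nd: "\<not> ?p ^ m dvd Rep_padic_int x ?k" "\<not> ?p ^ n dvd Rep_padic_int y ?k"
    using mn padic_coherent[of m ?k x] padic_coherent[of n ?k y] by (auto simp: dvd_eq_mod_eq_0)
  show "x * y \<noteq> 0"
  proof
    assume "x * y = 0"
    then have "(Rep_padic_int x ?k * Rep_padic_int y ?k) mod ?p ^ ?k = 0"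
      by (metis times_padic_int.rep_eq zero_padic_int.rep_eq)
    then have d: "?p ^ ?k dvd Rep_padic_int x ?k * Rep_padic_int y ?k" by auto
    have p: "prime_elem ?p"
      using prime_card[where 'a = 'a] by simp
    have "m \<noteq> 0" using nd(1) by (intro notI) simp
    then have "m + n = Suc (?k - 1)" by simp
    moreover have "?p ^ (?k - 1) dvd Rep_padic_int x ?k * Rep_padic_int y ?k"
      using d by (rule power_le_dvd) simp
    ultimately show False
      using prime_elem_power_dvd_cases[OF _ _ p] nd by blast
  qed
qed

text \<open>Reduction modulo \<open>p\<close>; the field \<open>\<rat>\<^sub>p\<close> is \<open>'p padic_int fract\<close>.\<close>

lift_definition padic_reduce :: "'p :: prime_card padic_int \<Rightarrow> 'p mod_ring"
  is "\<lambda>x. of_int_mod_ring (x 1)" .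

lemma padic_reduce_hom [simp]:
  fixes x y :: "'p :: prime_card padic_int"
  shows "padic_reduce 0 = (0 :: 'p mod_ring)" "padic_reduce 1 = (1 :: 'p mod_ring)"
    "padic_reduce (x + y) = padic_reduce x + padic_reduce y"
    "padic_reduce (x * y) = padic_reduce x * padic_reduce y"
proof -
  have m: "of_int (a mod int CARD('p)) = (of_int a :: 'p mod_ring)" for a
    unfolding of_int_of_int_mod_ring by transfer simp
  show "padic_reduce 0 = (0 :: 'p mod_ring)" "padic_reduce 1 = (1 :: 'p mod_ring)"
    "padic_reduce (x + y) = padic_reduce x + padic_reduce y"
    "padic_reduce (x * y) = padic_reduce x * padic_reduce y"
    by (simp_all add: padic_reduce.rep_eq padic_rep_eq m flip: of_int_of_int_mod_ring)
qed

text \<open>\<open>('a, 'd) quad_ext\<close> is \<open>'a[\<surd>-\<Delta>] = 'a[X]/(X\<^sup>2 + \<Delta>)\<close> with \<open>\<Delta> = CARD('d)\<close>; the element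
  \<open>a + b \<surd>-\<Delta>\<close> is \<open>Quad a b\<close>. The type \<open>'d\<close> only carries the number \<open>\<Delta>\<close>.\<close>

datatype ('a, 'd) quad_ext = Quad (quad_re: 'a) (quad_im: 'a)

instantiation quad_ext :: (comm_ring_1, finite) comm_ring_1
begin

definition "0 = Quad 0 0"
definition "1 = Quad 1 0"
definition "x + y = Quad (quad_re x + quad_re y) (quad_im x + quad_im y)"
definition "- x = Quad (- quad_re x) (- quad_im x)"
definition "x - y = Quad (quad_re x - quad_re y) (quad_im x - quad_im y)"
definition "x * y = Quad (quad_re x * quad_re y - of_nat CARD('b) * (quad_im x * quad_im y))
  (quad_re x * quad_im y + quad_im x * quad_re y)"

instance
  by standard
    (simp_all add: zero_quad_ext_def one_quad_ext_def plus_quad_ext_def uminus_quad_ext_def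
      minus_quad_ext_def times_quad_ext_def algebra_simps)

end

definition quad_root :: "('a :: comm_ring_1, 'd :: finite) quad_ext" where
  "quad_root = Quad 0 1"

lemma quad_root_square:
  "quad_root * quad_root = (- of_nat CARD('d) :: ('a :: comm_ring_1, 'd :: finite) quad_ext)"
proof -
  have "of_nat n = (Quad (of_nat n) 0 :: ('a, 'd) quad_ext)" for n
    by (induction n) (simp_all add: zero_quad_ext_def one_quad_ext_def plus_quad_ext_def)
  then show ?thesis
    by (simp add: quad_root_def times_quad_ext_def uminus_quad_ext_def)
qed

definition quad_conj :: "('a :: comm_ring_1, 'd :: finite) quad_ext \<Rightarrow> ('a, 'd) quad_ext" where
  "quad_conj x = Quad (quad_re x) (- quad_im x)"

definition quad_reduce ::
  "('p :: prime_card padic_int, 'd :: finite) quad_ext \<Rightarrow> ('p mod_ring, 'd) quad_ext" where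
  "quad_reduce x = Quad (padic_reduce (quad_re x)) (padic_reduce (quad_im x))"

section \<open>Inert primes and residue systems\<close>

definition imag_quad_field :: "nat \<Rightarrow> complex set" where
  "imag_quad_field \<Delta> = {of_rat a + of_rat b * csqrt (- of_nat \<Delta>) | a b. True}"

definition imag_quad_integers :: "nat \<Rightarrow> complex ring" where
  "imag_quad_integers \<Delta> =
    \<lparr>carrier = {x \<in> imag_quad_field \<Delta>. algebraic_int x}, mult = (*), one = 1, zero = 0, add = (+)\<rparr>"

definition inert :: "nat \<Rightarrow> nat \<Rightarrow> bool" where
  "inert \<Delta> p \<longleftrightarrow>
    prime p \<and> primeideal (PIdl\<^bsub>imag_quad_integers \<Delta>\<^esub> (of_nat p)) (imag_quad_integers \<Delta>)"

definition residue_system :: "nat \<Rightarrow> int set \<Rightarrow> bool" where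
  "residue_system m R \<longleftrightarrow> (\<forall>x. \<exists>!r. r \<in> R \<and> [r = x] (mod int m))"

section \<open>The groups\<close>

definition E_mat :: "'a :: ring_1 mat" where
  "E_mat = mat_diag 3 (\<lambda>i. if i = 0 then 1 else - 1)"

definition G_V :: "('p :: prime_card padic_int, 'd :: finite) quad_ext mat set" where
  "G_V = {g \<in> carrier_mat 3 3. \<exists>l :: 'p padic_int. l dvd 1 \<and>
    g * E_mat * transpose_mat (map_mat quad_conj g) = Quad l 0 \<cdot>\<^sub>m E_mat}"

definition alpha :: "('p :: prime_card padic_int, 'd :: finite) quad_ext mat \<Rightarrow> 'p padic_int mat" where
  "alpha g = (let h = map_mat quad_re g; k = map_mat quad_im g in
    four_block_mat h (k * E_mat)
      (- of_nat CARD('d) \<cdot>\<^sub>m (E_mat * k)) (E_mat * h * E_mat))"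

section \<open>The open part of \<open>S(3,1)\<close> and its decomposition\<close>

definition sigma :: "nat \<Rightarrow> int mat \<Rightarrow> int mat \<Rightarrow> int mat \<Rightarrow> int mat" where
  "sigma p A C U = four_block_mat
    (four_block_mat (int p \<cdot>\<^sub>m 1\<^sub>m 1) (0\<^sub>m 1 2) (- A) (1\<^sub>m 2))
    (four_block_mat (0\<^sub>m 1 1) (int p \<cdot>\<^sub>m transpose_mat C) C U)
    (0\<^sub>m 3 3)
    (four_block_mat (int p \<cdot>\<^sub>m 1\<^sub>m 1) (int p \<cdot>\<^sub>m transpose_mat A) (0\<^sub>m 2 1) (int p ^ 2 \<cdot>\<^sub>m 1\<^sub>m 2))"

text \<open>\<open>R\<close> and \<open>R'\<close> are the chosen systems of residues modulo \<open>p\<close> and \<open>p\<^sup>2\<close>.\<close>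

definition open_data :: "int set \<Rightarrow> int set \<Rightarrow> int mat \<Rightarrow> int mat \<Rightarrow> int mat \<Rightarrow> bool" where
  "open_data R R' A C U \<longleftrightarrow>
    A \<in> carrier_mat 2 1 \<and> C \<in> carrier_mat 2 1 \<and> U \<in> carrier_mat 2 2 \<and>
    elements_mat A \<subseteq> R \<and> elements_mat C \<subseteq> R \<and>
    (\<forall>i j. i \<le> j \<and> j < 2 \<longrightarrow> U $$ (i, j) \<in> R') \<and>
    C * transpose_mat A - A * transpose_mat C = U - transpose_mat U"

definition S_open :: "nat \<Rightarrow> int set \<Rightarrow> int set \<Rightarrow> int mat set" where
  "S_open p R R' = {sigma p A C U | A C U. open_data R R' A C U}"

definition mu1 :: "int mat \<Rightarrow> int mat \<Rightarrow> int mat \<Rightarrow>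
    ('p :: prime_card padic_int, 'd :: finite) quad_ext mat" where
  "mu1 A C U = four_block_mat
    (- 1\<^sub>m 1) (- (quad_root \<cdot>\<^sub>m transpose_mat (map_mat of_int C)))
    (map_mat of_int A + quad_root \<cdot>\<^sub>m map_mat of_int C) (- 1\<^sub>m 2 - quad_root \<cdot>\<^sub>m map_mat of_int U)"

definition mu2 :: "int mat \<Rightarrow> int mat \<Rightarrow> int mat \<Rightarrow>
    ('p :: prime_card padic_int, 'd :: finite) quad_ext mat" where
  "mu2 A C U = four_block_mat
    (quad_root \<cdot>\<^sub>m 1\<^sub>m 1) (- (quad_root \<cdot>\<^sub>m transpose_mat (map_mat of_int A)))
    (map_mat of_int A + quad_root \<cdot>\<^sub>m map_mat of_int C) (- 1\<^sub>m 2 - quad_root \<cdot>\<^sub>m map_mat of_int U)"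

definition det_red :: "('p :: prime_card padic_int, 'd :: finite) quad_ext mat \<Rightarrow> ('p mod_ring, 'd) quad_ext" where
  "det_red m = det (map_mat quad_reduce m)"

text \<open>\<open>n = (X\<^sub>1 X\<^sub>2; 0 1) m\<close> with \<open>rank (im X\<^sub>1 mod p) = j\<close>. When \<open>det m\<close> is a unit there is at most
  one such pair \<open>X\<^sub>1, X\<^sub>2\<close>.\<close>

definition im_rank_quotient ::
  "('p :: prime_card padic_int, 'd :: finite) quad_ext mat \<Rightarrow> ('p padic_int, 'd) quad_ext mat \<Rightarrow> nat \<Rightarrow> bool" where
  "im_rank_quotient n m j \<longleftrightarrow> (\<exists>X1 \<in> carrier_mat 1 1. \<exists>X2 \<in> carrier_mat 1 2.
    n = four_block_mat X1 X2 (0\<^sub>m 2 1) (1\<^sub>m 2) * m \<and>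
    vec_space.rank 1 (map_mat quad_im (map_mat quad_reduce X1)) = j)"

definition D_part :: "'p :: prime_card itself \<Rightarrow> 'd :: finite itself \<Rightarrow>
    int set \<Rightarrow> int set \<Rightarrow> nat \<Rightarrow> int mat set" where
  "D_part _ _ R R' j = {sigma CARD('p) A C U | A C U. open_data R R' A C U \<and>
    (let m1 = mu1 A C U :: ('p padic_int, 'd) quad_ext mat; m2 = mu2 A C U in
      det_red m1 \<noteq> 0 \<and> im_rank_quotient m2 m1 j \<or>
      det_red m1 = 0 \<and> det_red m2 \<noteq> 0 \<and> im_rank_quotient m1 m2 j)}"

definition D_star :: "'p :: prime_card itself \<Rightarrow> 'd :: finite itself \<Rightarrow>
    int set \<Rightarrow> int set \<Rightarrow> int mat set" where
  "D_star _ _ R R' = {sigma CARD('p) A C U | A C U. open_data R R' A C U \<and>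
    det_red (mu1 A C U :: ('p padic_int, 'd) quad_ext mat) = 0 \<and>
    det_red (mu2 A C U :: ('p padic_int, 'd) quad_ext mat) = 0}"

lemma D_part_subset: "D_part TYPE('p :: prime_card) TYPE('d :: finite) R R' j \<subseteq> S_open CARD('p) R R'"
  unfolding D_part_def S_open_def by blast

lemma D_star_subset: "D_star TYPE('p :: prime_card) TYPE('d :: finite) R R' \<subseteq> S_open CARD('p) R R'"
  unfolding D_star_def S_open_def by blast

section \<open>D-equivalence\<close>

definition D_equivalent :: "'p :: prime_card itself \<Rightarrow> 'd :: finite itself \<Rightarrow>
    int mat \<Rightarrow> int mat \<Rightarrow> bool" where
  "D_equivalent _ _ s1 s2 \<longleftrightarrow>
    (\<exists>g \<in> G_V :: ('p padic_int, 'd) quad_ext mat set. \<exists>t :: 'p padic_int fract mat.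
      inverts_mat (map_mat of_int s2) t \<and> inverts_mat t (map_mat of_int s2) \<and>
      elements_mat (map_mat of_int s1 * map_mat to_fract (alpha g) * t) \<subseteq> range to_fract)"

end

theory Submission
  imports Defs
begin

text \<open>Write \<open>\<omega> = \<surd>-\<Delta>\<close> and let \<open>P\<close> be the \<open>6 \<times> 3\<close> matrix with blocks \<open>-1\<close> and \<open>\<omega> E\<close>. Over \<open>\<int>\<^sub>p[\<omega>]\<close> the
  columns of \<open>P\<close> span a space on which \<open>\<alpha>(g)\<close> acts through the conjugate of \<open>g\<close>: \<open>\<alpha>(g) P = P g'\<close>,
  where \<open>g'\<close> is that conjugate. If \<open>\<sigma>\<^sub>1 \<alpha>(g) = T \<sigma>\<^sub>2\<close> with \<open>T\<close> integral, then therefore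
  \<open>(\<sigma>\<^sub>1 P) g' = T (\<sigma>\<^sub>2 P)\<close>.

  The matrix \<open>\<sigma> P\<close> carries \<open>\<mu>\<^sub>1\<close> and \<open>\<mu>\<^sub>2\<close>: if \<open>r\<^sub>1\<close> and \<open>r\<^sub>2\<close> are their top rows and \<open>N\<close> is the pair of
  lower rows that they share, then the rows of \<open>\<sigma> P\<close> are \<open>p r\<^sub>1\<close>, \<open>N\<close>, \<open>p r\<^sub>2\<close> and two rows divisible by
  \<open>p\<^sup>2\<close> (lemma \<open>sigma_frame\<close>). Compare the rows of the identity above. The entries of \<open>T\<close> lie in
  \<open>\<int>\<^sub>p\<close>, and the last two columns of \<open>N\<close> have minus the identity matrix as real
  part. So where the left side is divisible by \<open>p\<close>, the coefficients of \<open>T\<close> at the rows of \<open>N\<close> are divisible by \<open>p\<close> as well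
  (lemma \<open>real_combination_divisible\<close>), and the identity of such a row may be divided by \<open>p\<close>.
  Modulo \<open>p\<close>, the rows \<open>r\<^sub>1 g'\<close> and \<open>r\<^sub>2 g'\<close> made from \<open>\<sigma>\<^sub>1\<close> are thus combinations of the rows
  \<open>r\<^sub>1, r\<^sub>2, N\<close> made from \<open>\<sigma>\<^sub>2\<close>, and the rows of \<open>N g'\<close> are combinations of the rows of \<open>N\<close> alone.

  By linearity of the determinant in the top row, \<open>det (\<mu>\<^sub>i g')\<close> for \<open>\<sigma>\<^sub>1\<close> is then modulo \<open>p\<close> a linear
  combination of \<open>det \<mu>\<^sub>1\<close> and \<open>det \<mu>\<^sub>2\<close> for \<open>\<sigma>\<^sub>2\<close> (lemma \<open>det_zero_if_rows_in_span\<close>), and \<open>det g'\<close> is a unit.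
  Hence if both determinants vanish modulo \<open>p\<close> for \<open>\<sigma>\<^sub>2\<close>, they do for \<open>\<sigma>\<^sub>1\<close>: membership in \<open>D\<^sub>*\<close> passes
  from \<open>\<sigma>\<^sub>2\<close> to \<open>\<sigma>\<^sub>1\<close>, whereas an element of \<open>D\<^sub>0\<close> or \<open>D\<^sub>1\<close> has one of the two determinants nonzero.\<close>

section \<open>Arithmetic in \<open>\<int>\<^sub>p[\<surd>-\<Delta>]\<close>\<close>

lemma comm_ring_hom_quad_reduce:
  "comm_ring_hom (quad_reduce :: ('p :: prime_card padic_int, 'd :: finite) quad_ext \<Rightarrow> _)"
proof -
  have n: "padic_reduce (of_nat n :: 'p padic_int) = of_nat n" for n
    by (induction n) simp_all
  have m: "padic_reduce (- x) = - padic_reduce x" for x :: "'p padic_int"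
    using padic_reduce_hom(3)[of x "- x"] by (simp add: add_eq_0_iff2 add.commute)
  have d: "padic_reduce (x - y) = padic_reduce x - padic_reduce y" for x y :: "'p padic_int"
    using padic_reduce_hom(3)[of x "- y"] by (simp add: m)
  show ?thesis
    by standard
      (simp_all add: quad_reduce_def zero_quad_ext_def one_quad_ext_def plus_quad_ext_def
        times_quad_ext_def n d)
qed

lemma comm_ring_hom_quad_conj:
  "comm_ring_hom (quad_conj :: ('a :: comm_ring_1, 'd :: finite) quad_ext \<Rightarrow> _)"
  by standard
    (simp_all add: quad_conj_def zero_quad_ext_def one_quad_ext_def plus_quad_ext_def
      times_quad_ext_def algebra_simps)

definition quad_const :: "'a :: comm_ring_1 \<Rightarrow> ('a, 'd :: finite) quad_ext" where
  "quad_const x = Quad x 0"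

lemma comm_ring_hom_quad_const:
  "comm_ring_hom (quad_const :: 'a :: comm_ring_1 \<Rightarrow> ('a, 'd :: finite) quad_ext)"
  by standard
    (simp_all add: quad_const_def zero_quad_ext_def one_quad_ext_def plus_quad_ext_def
      times_quad_ext_def)

lemma quad_const_of_int:
  "(quad_const (of_int n :: 'a :: comm_ring_1) :: ('a, 'd :: finite) quad_ext) = of_int n"
proof -
  interpret comm_ring_hom "quad_const :: 'a \<Rightarrow> ('a, 'd) quad_ext"
    by (rule comm_ring_hom_quad_const)
  have "quad_const (of_nat m :: 'a) = (of_nat m :: ('a, 'd) quad_ext)" for m
    by (induction m) (simp_all add: hom_distribs)
  then show ?thesis
    by (cases n) (simp_all add: hom_distribs del: of_nat_Suc)
qed

lemma quad_of_nat:
  "(of_nat n :: ('a :: comm_ring_1, 'd :: finite) quad_ext) = Quad (of_nat n) 0"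
  using quad_const_of_int[of "int n", where 'a = 'a and 'd = 'd] by (simp add: quad_const_def)

lemma padic_of_nat_prime_nonzero: "(of_nat CARD('p) :: 'p :: prime_card padic_int) \<noteq> 0"
proof
  assume a: "(of_nat CARD('p) :: 'p padic_int) = 0"
  have "Rep_padic_int (of_nat n :: 'p padic_int) k = int n mod int CARD('p) ^ k" for n k
    by (induction n) (simp_all add: padic_rep_eq mod_simps)
  from this[of "CARD('p)" 2] a have "int CARD('p) mod int CARD('p) ^ 2 = 0"
    by (simp add: padic_rep_eq)
  then have "int CARD('p) ^ 2 dvd int CARD('p) ^ 1" by auto
  then have "CARD('p) = 1 \<or> CARD('p) = 0"
    by (subst (asm) dvd_power_iff) (auto)
  then show False using prime_card[where 'a = 'p] by auto
qed

lemma quad_prime_cancel: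
  fixes x y :: "('p :: prime_card padic_int, 'd :: finite) quad_ext"
  assumes "of_nat CARD('p) * x = of_nat CARD('p) * y"
  shows "x = y"
  using assms padic_of_nat_prime_nonzero[where 'p = 'p]
  by (cases x; cases y) (simp add: quad_of_nat times_quad_ext_def)

lemma quad_prime_eq_0:
  "(of_nat CARD('p) :: ('p :: prime_card mod_ring, 'd :: finite) quad_ext) = 0"
  by (simp only: quad_of_nat of_nat_card_eq_0 zero_quad_ext_def)

section \<open>Determinants of matrices that differ in the top row\<close>

lemma det_row_0_combination:
  fixes m m1 m2 :: "'a :: comm_ring_1 mat"
  assumes "m \<in> carrier_mat n n" "m1 \<in> carrier_mat n n" "m2 \<in> carrier_mat n n" "0 < n"
    and "\<And>i j. 0 < i \<Longrightarrow> i < n \<Longrightarrow> j < n \<Longrightarrow> m $$ (i, j) = m1 $$ (i, j)"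
    and "\<And>i j. 0 < i \<Longrightarrow> i < n \<Longrightarrow> j < n \<Longrightarrow> m $$ (i, j) = m2 $$ (i, j)"
    and "\<And>j. j < n \<Longrightarrow> m $$ (0, j) = c1 * m1 $$ (0, j) + c2 * m2 $$ (0, j)"
  shows "det m = c1 * det m1 + c2 * det m2"
proof -
  have "mat_delete m 0 j = mat_delete m1 0 j" "mat_delete m 0 j = mat_delete m2 0 j" if "j < n" for j
    using assms that by (auto simp: mat_delete_def intro!: eq_matI)
  then have cof: "cofactor m1 0 j = cofactor m 0 j" "cofactor m2 0 j = cofactor m 0 j" if "j < n" for j
    using that by (simp_all add: cofactor_def)
  have det: "det x = (\<Sum>j<n. x $$ (0, j) * cofactor x 0 j)" if "x \<in> carrier_mat n n" for x :: "'a mat"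
    using that \<open>0 < n\<close> by (rule laplace_expansion_row)
  have "det m = (\<Sum>j<n. c1 * (m1 $$ (0, j) * cofactor m1 0 j) + c2 * (m2 $$ (0, j) * cofactor m2 0 j))"
    unfolding det[OF assms(1)] using assms(7) cof
    by (intro sum.cong) (simp_all add: algebra_simps)
  also have "\<dots> = c1 * det m1 + c2 * det m2"
    unfolding det[OF assms(2)] det[OF assms(3)] by (simp only: sum.distrib sum_distrib_left)
  finally show ?thesis .
qed

text \<open>The matrix \<open>m\<close> is the product of a matrix of coefficients with the matrix whose top row is
  \<open>c1\<close> times that of \<open>m1\<close> plus \<open>c2\<close> times that of \<open>m2\<close> and whose lower rows are the common ones. The
  second factor has determinant \<open>c1 * det m1 + c2 * det m2\<close>.\<close>
lemma det_zero_if_rows_in_span: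
  fixes m m1 m2 :: "'a :: comm_ring_1 mat"
  assumes "m \<in> carrier_mat n n" "m1 \<in> carrier_mat n n" "m2 \<in> carrier_mat n n" "0 < n"
    and "\<And>i j. 0 < i \<Longrightarrow> i < n \<Longrightarrow> j < n \<Longrightarrow> m1 $$ (i, j) = m2 $$ (i, j)"
    and "det m1 = 0" "det m2 = 0"
    and "\<And>j. j < n \<Longrightarrow> m $$ (0, j) =
      c1 * m1 $$ (0, j) + c2 * m2 $$ (0, j) + (\<Sum>k = 1..<n. s k * m1 $$ (k, j))"
    and "\<And>i j. 0 < i \<Longrightarrow> i < n \<Longrightarrow> j < n \<Longrightarrow> m $$ (i, j) = (\<Sum>k = 1..<n. t i k * m1 $$ (k, j))"
  shows "det m = 0"
proof -
  define m' where "m' = mat n n (\<lambda>(i, j).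
    if i = 0 then c1 * m1 $$ (0, j) + c2 * m2 $$ (0, j) else m1 $$ (i, j))"
  define B where "B = mat n n (\<lambda>(i, k).
    if k = 0 then (if i = 0 then 1 else 0) else if i = 0 then s k else t i k)"
  have "det m' = c1 * det m1 + c2 * det m2"
    using assms by (intro det_row_0_combination[of _ n]) (simp_all add: m'_def)
  then have "det m' = 0" using assms by simp
  moreover have "m = B * m'"
  proof (rule eq_matI)
    fix i j assume "i < dim_row (B * m')" "j < dim_col (B * m')"
    then have ij: "i < n" "j < n" by (simp_all add: B_def m'_def)
    have "(B * m') $$ (i, j) = (\<Sum>k = 0..<n. B $$ (i, k) * m' $$ (k, j))"
      using ij by (simp add: B_def m'_def scalar_prod_def)
    also have "\<dots> = B $$ (i, 0) * m' $$ (0, j) + (\<Sum>k = 1..<n. B $$ (i, k) * m' $$ (k, j))"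
      using \<open>0 < n\<close> by (simp add: sum.atLeast_Suc_lessThan)
    also have "(\<Sum>k = 1..<n. B $$ (i, k) * m' $$ (k, j)) =
        (\<Sum>k = 1..<n. (if i = 0 then s k else t i k) * m1 $$ (k, j))"
      using ij by (intro sum.cong) (auto simp: B_def m'_def)
    also have "B $$ (i, 0) * m' $$ (0, j) + \<dots> = m $$ (i, j)"
      using ij assms(4,8,9) by (auto simp: B_def m'_def)
    finally show "m $$ (i, j) = (B * m') $$ (i, j)" ..
  qed (use assms in \<open>simp_all add: B_def m'_def\<close>)
  moreover have "det (B * m') = det B * det m'"
    by (rule det_mult[of _ n]) (simp_all add: B_def m'_def)
  ultimately show ?thesis by simp
qed

section \<open>The frame on which \<open>\<alpha>(g)\<close> acts by the conjugate of \<open>g\<close>\<close>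

text \<open>The blocks are \<open>-1\<close> and \<open>\<surd>-\<Delta> E\<close>. The overall sign is chosen to produce exactly the signs of
  \<open>\<mu>\<^sub>1\<close> and \<open>\<mu>\<^sub>2\<close> when \<open>\<sigma>\<close> is applied.\<close>
definition frame :: "('a :: comm_ring_1, 'd :: finite) quad_ext mat" where
  "frame = mat 6 3 (\<lambda>(i, j). if i = j then - 1
     else if i = j + 3 then (if j = 0 then quad_root else - quad_root) else 0)"

lemma less_6_cases: "(i :: nat) < 6 \<Longrightarrow> i = 0 \<or> i = 1 \<or> i = 2 \<or> i = 3 \<or> i = 4 \<or> i = 5"
  by auto

lemma less_3_cases: "(i :: nat) < 3 \<Longrightarrow> i = 0 \<or> i = 1 \<or> i = 2"
  by auto

lemma E_mat_mult_index:
  fixes k :: "'a :: ring_1 mat"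
  assumes "k \<in> carrier_mat 3 3" "i < 3" "j < 3"
  shows "(E_mat * k) $$ (i, j) = (if i = 0 then k $$ (i, j) else - k $$ (i, j))"
    and "(k * E_mat) $$ (i, j) = (if j = 0 then k $$ (i, j) else - k $$ (i, j))"
  using assms by (simp_all add: E_mat_def mat_diag_mult_left[of _ 3 3] mat_diag_mult_right[of _ 3 3])

text \<open>With \<open>g = h + k\<omega>\<close> and \<open>\<omega>\<^sup>2 = -\<Delta>\<close>, the upper block of the left side is
  \<open>-h + k E \<omega> E = -(h - k\<omega>)\<close> and the lower one is \<open>\<Delta> E k + E h E \<omega> E = \<omega> E (h - k\<omega>)\<close>.\<close>
lemma alpha_frame:
  fixes g :: "('p :: prime_card padic_int, 'd :: finite) quad_ext mat"
  assumes g: "g \<in> carrier_mat 3 3"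
  shows "map_mat quad_const (alpha g) * frame = frame * map_mat quad_conj g"
proof (rule eq_matI)
  have E [simp]: "(E_mat :: 'p padic_int mat) \<in> carrier_mat 3 3"
    by (simp add: E_mat_def)
  note [simp] = carrier_matD[OF E] carrier_matD[OF g]
  have s: "{0..<6} = {0,1,2,3,4,5::nat}" "{0..<3} = {0,1,2::nat}" by auto
  have [simp]: "map_mat quad_re g \<in> carrier_mat 3 3" "map_mat quad_im g \<in> carrier_mat 3 3"
    using g by simp_all
  have [simp]: "E_mat * map_mat quad_re g \<in> carrier_mat 3 3"
    by (rule mult_carrier_mat[OF E]) (simp add: g)
  fix i j assume "i < dim_row (frame * map_mat quad_conj g)" "j < dim_col (frame * map_mat quad_conj g)"
  then have i: "i < 6" and j: "j < 3" by (simp_all add: frame_def)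
  have al: "alpha g $$ (i, k) =
      (if i < 3 then if k < 3 then quad_re (g $$ (i, k)) else (if k = 3 then 1 else - 1) * quad_im (g $$ (i, k - 3))
       else if k < 3 then - of_nat CARD('d) * ((if i = 3 then 1 else - 1) * quad_im (g $$ (i - 3, k)))
       else (if (i = 3) = (k = 3) then 1 else - 1) * quad_re (g $$ (i - 3, k - 3)))" if "k < 6" for k
    using i that
    by (auto simp: alpha_def Let_def E_mat_mult_index g simp del: index_mult_mat(1))
  have "alpha g \<in> carrier_mat 6 6"
    by (rule carrier_matI) (simp_all add: alpha_def Let_def)
  then have "(map_mat quad_const (alpha g) * frame) $$ (i, j) =
      (\<Sum>k = 0..<6. quad_const (alpha g $$ (i, k)) * frame $$ (k, j))"
    using i j by (simp add: scalar_prod_def frame_def)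
  \<comment> \<open>Column \<open>j\<close> of the frame has only two nonzero entries, and a row only one.\<close>
  also have "\<dots> = - quad_const (alpha g $$ (i, j))
      + quad_const (alpha g $$ (i, j + 3)) * (if j = 0 then quad_root else - quad_root)"
    unfolding s using less_3_cases[OF j] by (elim disjE) (simp_all add: frame_def)
  also have "\<dots> = (if i < 3 then - quad_conj (g $$ (i, j))
      else (if i = 3 then quad_root else - quad_root) * quad_conj (g $$ (i - 3, j)))"
    using j by (auto simp: al quad_const_def quad_conj_def quad_root_def uminus_quad_ext_def
        plus_quad_ext_def times_quad_ext_def)
  also have "\<dots> = (\<Sum>k = 0..<3. frame $$ (i, k) * quad_conj (g $$ (k, j)))"
    unfolding s using less_6_cases[OF i] by (elim disjE) (simp_all add: frame_def)
  also have "\<dots> = (frame * map_mat quad_conj g) $$ (i, j)"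
    using i j g by (simp add: scalar_prod_def frame_def)
  finally show "(map_mat quad_const (alpha g) * frame) $$ (i, j) = (frame * map_mat quad_conj g) $$ (i, j)" .
qed (use g in \<open>simp_all add: alpha_def Let_def frame_def E_mat_def mat_diag_def\<close>)

lemma sigma_frame:
  assumes "A \<in> carrier_mat 2 1" "C \<in> carrier_mat 2 1" "U \<in> carrier_mat 2 2"
  shows "map_mat of_int (sigma p A C U) * frame =
    (mat 6 3 (\<lambda>(i, j). if i = 0 then of_nat p * mu1 A C U $$ (0, j)
       else if i < 3 then mu1 A C U $$ (i, j)
       else if i = 3 then of_nat p * mu2 A C U $$ (0, j)
       else if i = j + 3 then - (of_nat p ^ 2) * quad_root else 0)
     :: ('p :: prime_card padic_int, 'd :: finite) quad_ext mat)" (is "?L = ?R")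
proof (rule eq_matI)
  fix i j assume "i < dim_row ?R" "j < dim_col ?R"
  then have "i < 6" "j < 3" by (simp_all add: frame_def)
  have c [simp]: "dim_row A = 2" "dim_col A = 1" "dim_row C = 2" "dim_col C = 1"
     "dim_row U = 2" "dim_col U = 2" using assms by auto
  have s: "{0..<6} = {0,1,2,3,4,5::nat}" by auto
  show "?L $$ (i, j) = ?R $$ (i, j)"
    using less_6_cases[OF \<open>i < 6\<close>] less_3_cases[OF \<open>j < 3\<close>]
    by (elim disjE; simp add: sigma_def frame_def scalar_prod_def s mu1_def mu2_def
       four_block_mat_def)
qed (use assms in \<open>simp_all add: sigma_def frame_def\<close>)

section \<open>Descent of the rows modulo \<open>p\<close>\<close>

lemma mu_carrier:
  assumes "A \<in> carrier_mat 2 1" "C \<in> carrier_mat 2 1" "U \<in> carrier_mat 2 2"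
  shows "(mu1 A C U :: ('p :: prime_card padic_int, 'd :: finite) quad_ext mat) \<in> carrier_mat 3 3"
    "(mu2 A C U :: ('p :: prime_card padic_int, 'd :: finite) quad_ext mat) \<in> carrier_mat 3 3"
  using assms by (auto simp: mu1_def mu2_def intro!: carrier_matI)

lemma mu1_mu2_lower_rows:
  assumes "A \<in> carrier_mat 2 1" "C \<in> carrier_mat 2 1" "U \<in> carrier_mat 2 2"
    and "0 < i" "i < 3" "j < 3"
  shows "(mu1 A C U :: ('p :: prime_card padic_int, 'd :: finite) quad_ext mat) $$ (i, j) = mu2 A C U $$ (i, j)"
  using assms by (auto simp: mu1_def mu2_def)

text \<open>In column \<open>i \<in> {1, 2}\<close> the lower rows of \<open>\<mu>\<^sub>1\<close> have real part \<open>-1\<close> on the diagonal and \<open>0\<close> off it.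
  The coefficients \<open>t\<close> have no imaginary part, so the real part of the relation in column \<open>i\<close> reads
  \<open>p * quad_re (w i) = - t i + p * quad_re (z i)\<close>. This makes \<open>t i\<close> a multiple of \<open>p\<close>, and \<open>p\<close> cancels.\<close>
lemma real_combination_divisible:
  fixes w z :: "nat \<Rightarrow> ('p :: prime_card padic_int, 'd :: finite) quad_ext"
  defines "q \<equiv> (of_nat CARD('p) :: ('p padic_int, 'd) quad_ext)"
  assumes "A \<in> carrier_mat 2 1" "C \<in> carrier_mat 2 1" "U \<in> carrier_mat 2 2"
    and eq: "\<And>k. k < 3 \<Longrightarrow> q * w k =
      (\<Sum>i = 1..<3. quad_const (t i) * mu1 A C U $$ (i, k)) + q * z k"
  obtains s where "\<And>k. k < 3 \<Longrightarrow> w k = (\<Sum>i = 1..<3. quad_const (s i) * mu1 A C U $$ (i, k)) + z k"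
proof -
  \<comment> \<open>The value of \<open>t i / p\<close> that the real part of the relation in column \<open>i\<close> forces.\<close>
  define s where "s = (\<lambda>i. quad_re (z i) - quad_re (w i))"
  have c [simp]: "dim_row A = 2" "dim_col A = 1" "dim_row C = 2" "dim_col C = 1"
     "dim_row U = 2" "dim_col U = 2" using assms by auto
  have i: "(of_int n :: ('p padic_int, 'd) quad_ext) = Quad (of_int n) 0" for n
    by (simp add: quad_const_def flip: quad_const_of_int)
  have sum_12: "(\<Sum>i = 1..<3. f i) = f 1 + f 2" for f :: "nat \<Rightarrow> ('p padic_int, 'd) quad_ext"
    by (simp add: numeral_3_eq_3 numeral_2_eq_2)
  have t: "t i = of_nat CARD('p) * s i" if "i \<in> {1..<3}" for i
  proof -
    have "i = 1 \<or> i = 2" "i < 3" using that by auto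
    then have "quad_re (q * w i) = - t i + of_nat CARD('p) * quad_re (z i)"
      unfolding eq[OF \<open>i < 3\<close>] sum_12
      by (elim disjE) (simp_all add: mu1_def q_def i quad_of_nat quad_const_def quad_root_def
        zero_quad_ext_def one_quad_ext_def plus_quad_ext_def times_quad_ext_def
        uminus_quad_ext_def minus_quad_ext_def)
    then show ?thesis by (simp add: s_def q_def quad_of_nat times_quad_ext_def algebra_simps)
  qed
  interpret comm_ring_hom "quad_const :: 'p padic_int \<Rightarrow> ('p padic_int, 'd) quad_ext"
    by (rule comm_ring_hom_quad_const)
  have "w k = (\<Sum>i = 1..<3. quad_const (s i) * mu1 A C U $$ (i, k)) + z k" if "k < 3" for k
  proof (rule quad_prime_cancel)
    have "of_nat CARD('p) * w k =
        (\<Sum>i = 1..<3. quad_const (of_nat CARD('p) * s i) * mu1 A C U $$ (i, k)) + of_nat CARD('p) * z k"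
      using eq[OF that] unfolding q_def by (simp add: t)
    then show "of_nat CARD('p) * w k =
        of_nat CARD('p) * ((\<Sum>i = 1..<3. quad_const (s i) * mu1 A C U $$ (i, k)) + z k)"
      by (simp add: hom_distribs hom_of_nat sum_distrib_left algebra_simps)
  qed
  then show thesis by (rule that)
qed

text \<open>Take determinants in the relation defining \<open>G_V\<close>; both \<open>\<lambda>\<close> and \<open>det E\<close> are units.\<close>
lemma G_V_det_unit:
  fixes g :: "('p :: prime_card padic_int, 'd :: finite) quad_ext mat"
  assumes "g \<in> G_V"
  shows "det (map_mat quad_conj g) dvd 1"
proof -
  obtain l :: "'p padic_int" where g: "g \<in> carrier_mat 3 3" and l: "l dvd 1"
    and eq: "g * E_mat * transpose_mat (map_mat quad_conj g) = Quad l 0 \<cdot>\<^sub>m E_mat"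
    using assms unfolding G_V_def by blast
  interpret comm_ring_hom "quad_const :: 'p padic_int \<Rightarrow> ('p padic_int, 'd) quad_ext"
    by (rule comm_ring_hom_quad_const)
  have E: "(E_mat :: ('p padic_int, 'd) quad_ext mat) \<in> carrier_mat 3 3"
    by (simp add: E_mat_def)
  have "E_mat * E_mat = (1\<^sub>m 3 :: ('p padic_int, 'd) quad_ext mat)"
    unfolding E_mat_def mat_diag_diag by (rule eq_matI) (auto simp: mat_diag_def)
  then have "det E_mat * det E_mat = (1 :: ('p padic_int, 'd) quad_ext)"
    by (metis E det_mult det_one)
  then have "det E_mat dvd (1 :: ('p padic_int, 'd) quad_ext)"
    by (metis dvd_triv_left)
  moreover have "(Quad l 0 :: ('p padic_int, 'd) quad_ext) dvd 1"
    using hom_dvd[OF l] by (simp add: quad_const_def one_quad_ext_def)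
  ultimately have "Quad l 0 ^ 3 * det E_mat dvd (1 ^ 3 * 1 :: ('p padic_int, 'd) quad_ext)"
    by (intro mult_dvd_mono dvd_power_same)
  moreover have "det g * det E_mat * det (map_mat quad_conj g) = Quad l 0 ^ 3 * det E_mat"
    using arg_cong[OF eq, of det] g E
    by (simp add: det_mult[of _ 3] det_transpose[of _ 3] mult.assoc)
  ultimately show ?thesis by (metis dvd_mult_right power_one mult_1_right)
qed

text \<open>The vanishing of both reduced determinants passes from \<open>(A', C', U')\<close> to \<open>(A, C, U)\<close>. Both are
  assumed together, because the top row of either matrix of the first triple may involve the top rows of both
  matrices of the second one.\<close>
lemma det_red_zero_transfer:
  fixes g :: "('p :: prime_card padic_int, 'd :: finite) quad_ext mat"
  defines "m1 \<equiv> \<lambda>A C U. (mu1 A C U :: ('p padic_int, 'd) quad_ext mat)"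
    and "m2 \<equiv> \<lambda>A C U. (mu2 A C U :: ('p padic_int, 'd) quad_ext mat)"
  assumes g: "g \<in> carrier_mat 3 3" "det (map_mat quad_conj g) dvd 1"
    and T: "T \<in> carrier_mat 6 6"
    and c: "A \<in> carrier_mat 2 1" "C \<in> carrier_mat 2 1" "U \<in> carrier_mat 2 2"
    and c': "A' \<in> carrier_mat 2 1" "C' \<in> carrier_mat 2 1" "U' \<in> carrier_mat 2 2"
    and eq: "map_mat of_int (sigma CARD('p) A C U) * alpha g = T * map_mat of_int (sigma CARD('p) A' C' U')"
    and d1: "det_red (m1 A' C' U') = 0" and d2: "det_red (m2 A' C' U') = 0"
  shows "det_red (m1 A C U) = 0" "det_red (m2 A C U) = 0"
proof -
  let ?S = "\<lambda>A C U. map_mat of_int (sigma CARD('p) A C U) :: ('p padic_int, 'd) quad_ext mat"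
  let ?q = "of_nat CARD('p) :: ('p padic_int, 'd) quad_ext"
  let ?P = "frame :: ('p padic_int, 'd) quad_ext mat"
  interpret r: comm_ring_hom "quad_reduce :: ('p padic_int, 'd) quad_ext \<Rightarrow> _"
    by (rule comm_ring_hom_quad_reduce)
  interpret c: comm_ring_hom "quad_const :: 'p padic_int \<Rightarrow> ('p padic_int, 'd) quad_ext"
    by (rule comm_ring_hom_quad_const)
  define G where "G = map_mat quad_conj g"
  define T' where "T' = (map_mat quad_const T :: ('p padic_int, 'd) quad_ext mat)"
  define M' where "M' = ?S A' C' U' * ?P"
  have car: "alpha g \<in> carrier_mat 6 6" "?P \<in> carrier_mat 6 3" "G \<in> carrier_mat 3 3"
    "T' \<in> carrier_mat 6 6"
    using g T by (auto simp: G_def T'_def frame_def alpha_def Let_def E_mat_def mat_diag_def intro!: carrier_matI)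
  have sig: "map_mat f (sigma CARD('p) a c u) \<in> carrier_mat 6 6"
    if "a \<in> carrier_mat 2 1" "c \<in> carrier_mat 2 1" "u \<in> carrier_mat 2 2"
    for a c u and f :: "int \<Rightarrow> 'x"
    using that by (auto simp: sigma_def intro!: carrier_matI)
  have lift: "map_mat quad_const (map_mat of_int (sigma CARD('p) a c u) :: 'p padic_int mat) = ?S a c u" for a c u
    by (rule eq_matI) (simp_all add: quad_const_of_int)
  have eq': "?S A C U * ?P * G = T' * M'"
  proof -
    have "?S A C U * map_mat quad_const (alpha g) = T' * ?S A' C' U'"
      using arg_cong[OF eq, of "map_mat (quad_const :: _ \<Rightarrow> (_, 'd) quad_ext)"]
      by (simp only: c.mat_hom_mult[OF sig[OF c] car(1)] c.mat_hom_mult[OF T sig[OF c']] lift T'_def)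
    moreover have "?S A C U * ?P * G = ?S A C U * (?P * G)"
      using sig[OF c] car by (intro assoc_mult_mat) auto
    moreover have "?P * G = map_mat quad_const (alpha g) * ?P"
      using alpha_frame[OF g(1)] by (simp add: G_def)
    moreover have "?S A C U * (map_mat quad_const (alpha g) * ?P) = ?S A C U * map_mat quad_const (alpha g) * ?P"
      using sig[OF c] car by (intro assoc_mult_mat[symmetric]) auto
    moreover have "T' * ?S A' C' U' * ?P = T' * M'"
      unfolding M'_def using sig[OF c'] car by (intro assoc_mult_mat) auto
    ultimately show ?thesis by simp
  qed
  \<comment> \<open>Row \<open>i\<close> of \<open>T\<close> times the rows of \<open>M'\<close> with index \<open>0, 3, 4, 5\<close>, which are multiples
    of \<open>p\<close>, divided by \<open>p\<close>; the terms from the last two rows keep a factor \<open>p\<close>.\<close>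
  define z where "z i k = quad_const (T $$ (i, 0)) * m1 A' C' U' $$ (0, k)
    + quad_const (T $$ (i, 3)) * m2 A' C' U' $$ (0, k)
    - ?q * (if k = 0 then 0 else quad_root * quad_const (T $$ (i, k + 3)))" for i k
  have TN: "(T' * M') $$ (i, k) =
      (\<Sum>j = 1..<3. quad_const (T $$ (i, j)) * mu1 A' C' U' $$ (j, k)) + ?q * z i k"
    if "i < 6" "k < 3" for i k
  proof -
    have s: "{0..<6} = {0,1,2,3,4,5::nat}" by auto
    have s': "{1..<3} = {1,2::nat}" by auto
    have "(T' * M') $$ (i, k) = (\<Sum>j = 0..<6. quad_const (T $$ (i, j)) * M' $$ (j, k))"
      using that T by (simp add: T'_def M'_def sigma_frame[OF c'] scalar_prod_def)
    then show ?thesis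
      unfolding s s' using less_3_cases[OF \<open>k < 3\<close>]
      by (elim disjE; simp add: M'_def sigma_frame[OF c'] z_def m1_def m2_def algebra_simps power2_eq_square)
  qed
  \<comment> \<open>\<open>W\<close> will be \<open>\<mu>\<^sub>1 G\<close> with \<open>i = 0\<close> and \<open>\<mu>\<^sub>2 G\<close> with \<open>i = 3\<close>: in both cases its top row is row \<open>i\<close>
    of the matrix identity divided by \<open>p\<close>.\<close>
  have vanish: "det (map_mat quad_reduce W) = 0"
    if W: "W \<in> carrier_mat 3 3" and i: "i < 6"
      and W0: "\<And>k. k < 3 \<Longrightarrow> ?q * W $$ (0, k) = (T' * M') $$ (i, k)"
      and W1: "\<And>j k. 0 < j \<Longrightarrow> j < 3 \<Longrightarrow> k < 3 \<Longrightarrow> W $$ (j, k) = (T' * M') $$ (j, k)"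
    for W i
  proof -
    have "?q * W $$ (0, k) =
        (\<Sum>j = 1..<3. quad_const (T $$ (i, j)) * mu1 A' C' U' $$ (j, k)) + ?q * z i k" if "k < 3" for k
      using W0[OF that] TN[OF i that] by simp
    then obtain s where s: "\<And>k. k < 3 \<Longrightarrow>
        W $$ (0, k) = (\<Sum>j = 1..<3. quad_const (s j) * mu1 A' C' U' $$ (j, k)) + z i k"
      using real_combination_divisible[OF c', of "\<lambda>k. W $$ (0, k)" "\<lambda>j. T $$ (i, j)" "z i"] by blast
    note mu' = mu_carrier[OF c', where 'p = 'p and 'd = 'd]
    show ?thesis
    proof (rule det_zero_if_rows_in_span)
      show "det (map_mat quad_reduce (m1 A' C' U')) = 0" "det (map_mat quad_reduce (m2 A' C' U')) = 0"
        using d1 d2 by (simp_all add: det_red_def)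
      show "map_mat quad_reduce W $$ (0, k) =
          quad_reduce (quad_const (T $$ (i, 0))) * map_mat quad_reduce (m1 A' C' U') $$ (0, k)
          + quad_reduce (quad_const (T $$ (i, 3))) * map_mat quad_reduce (m2 A' C' U') $$ (0, k)
          + (\<Sum>j = 1..<3. quad_reduce (quad_const (s j)) * map_mat quad_reduce (m1 A' C' U') $$ (j, k))"
        if "k < 3" for k
        using s[OF that] that W mu'
        by (simp add: z_def hom_distribs quad_prime_eq_0 m1_def m2_def)
      show "map_mat quad_reduce W $$ (j, k) =
          (\<Sum>l = 1..<3. quad_reduce (quad_const (T $$ (j, l))) * map_mat quad_reduce (m1 A' C' U') $$ (l, k))"
        if "0 < j" "j < 3" "k < 3" for j k
        using W1[OF that] TN[of j k] that W mu'
        by (simp add: hom_distribs quad_prime_eq_0 m1_def)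
    qed (use W mu' in \<open>simp_all add: m1_def m2_def mu1_mu2_lower_rows[OF c']\<close>)
  qed
  have unit: "quad_reduce (det G) dvd 1"
    using r.hom_dvd[OF g(2)] by (simp add: G_def)
  have cancel: "det_red M = 0" if "M \<in> carrier_mat 3 3" "det (map_mat quad_reduce (M * G)) = 0"
    for M :: "('p padic_int, 'd) quad_ext mat"
  proof -
    have "det_red M * quad_reduce (det G) = 0"
      using that car(3) by (simp add: det_red_def det_mult[of _ 3] hom_distribs)
    moreover obtain v where "1 = quad_reduce (det G) * v" using unit by (elim dvdE)
    ultimately show ?thesis by (metis mult.assoc mult_1_right mult_zero_left)
  qed
  note mu = mu_carrier[OF c, where 'p = 'p and 'd = 'd]
  have SPG: "(T' * M') $$ (i, k) = (\<Sum>j = 0..<3. (?S A C U * ?P) $$ (i, j) * G $$ (j, k))"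
    if "i < 6" "k < 3" for i k
    unfolding eq'[symmetric] using that car(3) by (simp add: scalar_prod_def sigma_frame[OF c])
  have mG: "(M * G) $$ (i, k) = (\<Sum>j = 0..<3. M $$ (i, j) * G $$ (j, k))"
    if "M \<in> carrier_mat 3 3" "i < 3" "k < 3" for M i k
    using that car(3) by (simp add: scalar_prod_def)
  show "det_red (m1 A C U) = 0"
    using mu(1) car(3) unfolding m1_def
    by (intro cancel vanish[of _ 0])
      (simp_all add: SPG mG sigma_frame[OF c] sum_distrib_left mult.assoc del: index_mult_mat(1))
  show "det_red (m2 A C U) = 0"
    using mu(2) car(3) unfolding m2_def
    by (intro cancel vanish[of _ 3])
      (simp_all add: SPG mG sigma_frame[OF c] sum_distrib_left mult.assoc mu1_mu2_lower_rows[OF c]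
        del: index_mult_mat(1))
qed

section \<open>D-equivalence\<close>

text \<open>The factor \<open>T\<close> is \<open>S\<^sub>1 X S\<^sub>2\<^sup>-\<^sup>1\<close>, pulled back from the fraction field. This replaces the condition on
  an inverse over the fraction field by an identity between matrices over the ring.\<close>
lemma integral_quotient:
  fixes X :: "'a :: idom mat" and t :: "'a fract mat"
  assumes c: "S1 \<in> carrier_mat n n" "X \<in> carrier_mat n n" "S2 \<in> carrier_mat n n"
    and t: "inverts_mat (map_mat of_int S2) t" "inverts_mat t (map_mat of_int S2)"
    and int: "elements_mat (map_mat of_int S1 * map_mat to_fract X * t) \<subseteq> range to_fract"
  obtains T where "T \<in> carrier_mat n n" "map_mat of_int S1 * X = T * map_mat of_int S2"
proof -
  let ?L = "map_mat of_int S1 * map_mat to_fract X * t" and ?S = "map_mat of_int S2 :: 'a fract mat"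
  interpret f: inj_idom_hom "to_fract :: 'a \<Rightarrow> 'a fract"
    by standard simp_all
  have h: "map_mat to_fract (map_mat of_int S :: 'a mat) = map_mat of_int S" for S
    by (rule eq_matI) (simp_all add: f.hom_of_int)
  have tS: "?S * t = 1\<^sub>m n" "t * ?S = 1\<^sub>m (dim_row t)"
    using t c by (simp_all add: inverts_mat_def)
  have tc: "t \<in> carrier_mat n n"
    using arg_cong[OF tS(1), of dim_col] arg_cong[OF tS(2), of dim_col] c(3)
    by (auto intro!: carrier_matI)
  define T where "T = map_mat (inv_into UNIV to_fract) ?L"
  have L: "?L \<in> carrier_mat n n" using c tc by auto
  then have T: "T \<in> carrier_mat n n" by (simp add: T_def)
  have "map_mat to_fract T = ?L"
  proof (rule eq_matI)
    fix i j assume ij: "i < dim_row ?L" "j < dim_col ?L"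
    then have "?L $$ (i, j) \<in> elements_mat ?L"
      using carrier_matD[OF L] by (intro elements_matI[OF L, of i j]) (simp_all only:)
    with int have "?L $$ (i, j) \<in> range to_fract" by (rule subsetD)
    then show "map_mat to_fract T $$ (i, j) = ?L $$ (i, j)"
      using ij by (simp add: T_def f_inv_into_f del: index_mult_mat(1))
  qed (simp_all add: T_def)
  then have "map_mat to_fract T * ?S = map_mat of_int S1 * map_mat to_fract X * (t * ?S)"
    using c tc by (simp add: assoc_mult_mat[of _ n n _ n _ n])
  also have "\<dots> = map_mat of_int S1 * map_mat to_fract X"
    using tS(2) tc c by (simp add: right_mult_one_mat[of _ n n])
  finally have "map_mat to_fract (map_mat of_int S1 * X) = map_mat to_fract (T * map_mat of_int S2)"
    using c T by (simp add: f.mat_hom_mult[of _ n n _ n] h)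
  then have "map_mat of_int S1 * X = T * map_mat of_int S2"
    by (rule f.mat_hom_inj)
  with T show thesis by (rule that)
qed

theorem proposition4p2p17:
  fixes p \<Delta> :: nat and R R' :: "int set" and \<sigma>1 \<sigma>2 :: "int mat"
  assumes "CARD('p :: prime_card) = p" and "odd p"
    and "CARD('d :: finite) = \<Delta>" and "squarefree \<Delta>"
    and "inert \<Delta> p"
    and "residue_system p R" and "residue_system (p ^ 2) R'"
    and "\<sigma>1 \<in> D_part TYPE('p) TYPE('d) R R' 0 \<union> D_part TYPE('p) TYPE('d) R R' 1"
    and "\<sigma>2 \<in> D_star TYPE('p) TYPE('d) R R'"
  shows "\<not> D_equivalent TYPE('p) TYPE('d) \<sigma>1 \<sigma>2"
proof
  assume "D_equivalent TYPE('p) TYPE('d) \<sigma>1 \<sigma>2"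
  then obtain g :: "('p padic_int, 'd) quad_ext mat" and t :: "'p padic_int fract mat"
    where g: "g \<in> G_V"
      and t: "inverts_mat (map_mat of_int \<sigma>2) t" "inverts_mat t (map_mat of_int \<sigma>2)"
      and int: "elements_mat (map_mat of_int \<sigma>1 * map_mat to_fract (alpha g) * t) \<subseteq> range to_fract"
    unfolding D_equivalent_def by blast
  obtain A C U where s1: "\<sigma>1 = sigma CARD('p) A C U" and o1: "open_data R R' A C U"
    and nz: "det_red (mu1 A C U :: ('p padic_int, 'd) quad_ext mat) \<noteq> 0 \<or>
      det_red (mu2 A C U :: ('p padic_int, 'd) quad_ext mat) \<noteq> 0"
    using assms(8) unfolding D_part_def Let_def by blast
  obtain A' C' U' where s2: "\<sigma>2 = sigma CARD('p) A' C' U'" and o2: "open_data R R' A' C' U'"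
    and z: "det_red (mu1 A' C' U' :: ('p padic_int, 'd) quad_ext mat) = 0"
      "det_red (mu2 A' C' U' :: ('p padic_int, 'd) quad_ext mat) = 0"
    using assms(9) unfolding D_star_def by blast
  have c: "A \<in> carrier_mat 2 1" "C \<in> carrier_mat 2 1" "U \<in> carrier_mat 2 2"
    "A' \<in> carrier_mat 2 1" "C' \<in> carrier_mat 2 1" "U' \<in> carrier_mat 2 2"
    using o1 o2 by (simp_all add: open_data_def)
  have sig: "\<sigma>1 \<in> carrier_mat 6 6" "\<sigma>2 \<in> carrier_mat 6 6"
    using c by (auto simp: s1 s2 sigma_def intro!: carrier_matI)
  have g3: "g \<in> carrier_mat 3 3" using g by (simp add: G_V_def)
  then have al: "alpha g \<in> carrier_mat 6 6"
    by (auto simp: alpha_def Let_def E_mat_def mat_diag_def intro!: carrier_matI)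
  obtain T where T: "T \<in> carrier_mat 6 6"
    and eq: "map_mat of_int \<sigma>1 * alpha g = T * map_mat of_int \<sigma>2"
    using integral_quotient[OF sig(1) al sig(2) t int] .
  show False
    using det_red_zero_transfer[OF g3 G_V_det_unit[OF g] T c eq[unfolded s1 s2] z] nz by blast
qed

end
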